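(* Let $\mathcal{P}, \mathcal{Q} \subset \mathbb{R}^{n}$ be rational polytopes such that $\mathcal{P} \oplus \mathcal{Q}$ is a free sum. Then $$\sigma_{\operatorname{cone}(\mathcal{P} \oplus \mathcal{Q})}(\mathbf{z}) = (1 - z_{n+1})\,\sigma_{\operatorname{cone} \mathcal{P}}(\mathbf{z})\, \sigma_{\operatorname{cone} \mathcal{Q}}(\mathbf{z})$$ if and only if either $\mathcal{P}^\vee$ or $\mathcal{Q}^\vee$ is a lattice polyhedron.
   Context: A rational polytope is a polytope with all vertices in $\mathbb{Q}^n$. For convex $\mathcal{J},\mathcal{K}\subset\mathbb{R}^n$, $\mathcal{J}\oplus\mathcal{K}:=\operatorname{conv}(\mathcal{J}\cup\mathcal{K})$; "$\mathcal{J}\oplus\mathcal{K}$ is a free sum" means there is $g\in\mathsf{SL}_n(\mathbb{Z})$ such that $g\mathcal{J}$ and $g\mathcal{K}$ each contain the origin and their linear spans are orthogonal coordinate subspaces (spanned by subsets of the standard basis vectors). For convex $\mathcal{K}\subset\mathbb{R}^n$, $\operatorname{cone}\mathcal{K}\subset\mathbb{R}^{n+1}$ is the set of all nonnegative scalar multiples of points $(a,1)$, $a\in\mathcal{K}$. For $S\subset\mathbb{R}^{n+1}$, $\sigma_S(\mathbf{z})=\sum_{m\in S\cap\mathbb{Z}^{n+1}} z_1^{m_1}\cdots z_{n+1}^{m_{n+1}}$. For a polytope $\mathcal{P}$ containing the origin, its polar dual (relative to its linear span) is $\mathcal{P}^\vee=\{\phi\in(\operatorname{lin}\mathcal{P})^*: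 \phi(a)\le 1 \text{ for all } a\in\mathcal{P}\}$, a polyhedron; it is a lattice polyhedron if all its vertices lie in the dual lattice $\{\phi\in(\operatorname{lin}\mathcal{P})^*:\phi(a)\in\mathbb{Z}\text{ for all }a\in\operatorname{lin}\mathcal{P}\cap\mathbb{Z}^n\}$. *)

theory Defs
  imports
    "HOL-Analysis.Analysis"
    "HOL-Library.Poly_Mapping"
    "HOL-Computational_Algebra.Formal_Power_Series"
begin

section \<open>Rational polytopes and free sums\<close>

definition rational_polytope :: "(real ^ 'n) set \<Rightarrow> bool" where
  "rational_polytope P \<longleftrightarrow>
     polytope P \<and> (\<forall>v. v extreme_point_of P \<longrightarrow> (\<forall>i. v $ i \<in> \<rat>))"

definition conv_sum :: "(real ^ 'n) set \<Rightarrow> (real ^ 'n) set \<Rightarrow> (real ^ 'n) set" where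
  "conv_sum J K = convex hull (J \<union> K)"

definition SL_int :: "(real ^ 'n ^ 'n) set" where
  "SL_int = {g. (\<forall>i j. g $ i $ j \<in> \<int>) \<and> det g = 1}"

definition coordinate_subspace :: "(real ^ 'n) set \<Rightarrow> bool" where
  "coordinate_subspace V \<longleftrightarrow> (\<exists>A :: 'n set. V = span ((\<lambda>i. axis i 1) ` A))"

definition free_sum :: "(real ^ 'n) set \<Rightarrow> (real ^ 'n) set \<Rightarrow> bool" where
  "free_sum J K \<longleftrightarrow> (\<exists>g \<in> SL_int.
     0 \<in> (*v) g ` J \<and> 0 \<in> (*v) g ` K \<and>
     coordinate_subspace (span ((*v) g ` J)) \<and>
     coordinate_subspace (span ((*v) g ` K)) \<and>
     (\<forall>x \<in> span ((*v) g ` J). \<forall>y \<in> span ((*v) g ` K). orthogonal x y))"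

section \<open>Lattice-point generating functions of cones\<close>

text \<open>The space \<open>\<real>\<^sup>n\<^sup>+\<^sup>1\<close> is \<open>(real ^ 'n) \<times> real\<close>, with the last coordinate as second component.\<close>

definition cone_over :: "(real ^ 'n) set \<Rightarrow> ((real ^ 'n) \<times> real) set" where
  "cone_over K = {r *\<^sub>R (a, 1) | r a. 0 \<le> r \<and> a \<in> K}"

definition real_vec :: "int ^ 'n \<Rightarrow> real ^ 'n" where
  "real_vec a = (\<chi> i. real_of_int (a $ i))"

text \<open>
  Generating functions are formal. The group ring \<open>int ^ 'n \<Rightarrow>\<^sub>0 int\<close> is the ring of integer
  Laurent polynomials in \<open>z\<^sub>1, \<dots>, z\<^sub>n\<close>, the monomial with exponent vector \<open>a\<close> being
  \<open>Poly_Mapping.single a 1\<close>; \<open>fps_X\<close> is \<open>z\<^sub>n\<^sub>+\<^sub>1\<close>. This ring contains the series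
  \<open>\<Sum>m \<in> S \<inter> \<int>\<^sup>n\<^sup>+\<^sup>1. z\<^sup>m\<close> whenever \<open>S\<close> lies in the half-space \<open>x\<^sub>n\<^sub>+\<^sub>1 \<ge> 0\<close> and
  every slice \<open>x\<^sub>n\<^sub>+\<^sub>1 = k\<close> has finitely many lattice points; for cones over bounded sets see
  \<open>cone_over_half_space\<close>, \<open>finite_cone_over_slice\<close> and \<open>coeff_lattice_gf_cone_over\<close> below.
\<close>

definition lattice_gf :: "((real ^ 'n) \<times> real) set \<Rightarrow> (int ^ 'n \<Rightarrow>\<^sub>0 int) fps" where
  "lattice_gf S = Abs_fps (\<lambda>k. \<Sum>a | (real_vec a, real k) \<in> S. Poly_Mapping.single a 1)"

lemma cone_over_half_space: "(x, t) \<in> cone_over K \<Longrightarrow> 0 \<le> t"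
  by (auto simp: cone_over_def)

lemma finite_cone_over_slice:
  fixes K :: "(real ^ 'n) set"
  assumes "bounded K"
  shows "finite {a. (real_vec a, real k) \<in> cone_over K}"
proof -
  obtain B where B: "\<And>x. x \<in> K \<Longrightarrow> norm x \<le> B"
    using assms by (auto simp: bounded_iff)
  define N where "N = \<lceil>real k * B\<rceil>"
  have sub: "vec_nth ` {a :: int ^ 'n. (real_vec a, real k) \<in> cone_over K}
               \<subseteq> PiE UNIV (\<lambda>_. {- N..N})"
  proof (clarsimp simp: cone_over_def PiE_UNIV_domain)
    fix a :: "int ^ 'n" and x :: "real ^ 'n" and i
    assume a: "real_vec a = real k *\<^sub>R x" and x: "x \<in> K"
    have "\<bar>real_of_int (a $ i)\<bar> = \<bar>real_vec a $ i\<bar>"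
      by (simp add: real_vec_def)
    also have "\<dots> \<le> norm (real_vec a)"
      by (rule component_le_norm_cart)
    also have "\<dots> \<le> real k * B"
      using B[OF x] by (simp add: a mult_left_mono)
    also have "\<dots> \<le> real_of_int N"
      by (simp add: N_def)
    finally show "- N \<le> a $ i \<and> a $ i \<le> N"
      by linarith
  qed
  have "finite (PiE (UNIV :: 'n set) (\<lambda>_. {- N..N}))"
    by (intro finite_PiE) auto
  from finite_subset[OF sub this] show ?thesis
    by (rule finite_imageD) (auto simp: inj_on_def vec_eq_iff)
qed

lemma coeff_lattice_gf_cone_over:
  fixes K :: "(real ^ 'n) set"
  assumes "bounded K"
  shows "Poly_Mapping.lookup (fps_nth (lattice_gf (cone_over K)) k) a =
           (if (real_vec a, real k) \<in> cone_over K then 1 else 0)"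
proof -
  have "Poly_Mapping.lookup (\<Sum>x\<in>A. Poly_Mapping.single x 1) a = (\<Sum>x\<in>A. if x = a then (1 :: int) else 0)"
    for A :: "(int ^ 'n) set"
    by (induction A rule: infinite_finite_induct)
      (auto simp: Poly_Mapping.lookup_add lookup_single when_def)
  then show ?thesis
    using finite_cone_over_slice[OF assms, of k] by (simp add: lattice_gf_def)
qed

section \<open>Polar duals\<close>

text \<open>
  The dual space \<open>V\<^sup>*\<close> of a subspace \<open>V\<close> is realised inside the bounded functionals on
  \<open>real ^ 'n\<close>: a functional on \<open>V\<close> is identified with its extension by \<open>0\<close> on the
  orthogonal complement of \<open>V\<close>, see \<open>dual_space_extension\<close> below. The identification is linear,
  so it preserves vertices.
\<close>

definition dual_space :: "(real ^ 'n) set \<Rightarrow> ((real ^ 'n) \<Rightarrow>\<^sub>L real) set" where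
  "dual_space V = {\<phi>. \<forall>x. (\<forall>v \<in> V. orthogonal v x) \<longrightarrow> blinfun_apply \<phi> x = 0}"

lemma dual_space_extension:
  fixes V :: "(real ^ 'n) set" and f :: "real ^ 'n \<Rightarrow> real"
  assumes V: "subspace V"
    and add: "\<And>x y. x \<in> V \<Longrightarrow> y \<in> V \<Longrightarrow> f (x + y) = f x + f y"
    and scale: "\<And>c x. x \<in> V \<Longrightarrow> f (c *\<^sub>R x) = c * f x"
  shows "\<exists>!\<phi>. \<phi> \<in> dual_space V \<and> (\<forall>x \<in> V. blinfun_apply \<phi> x = f x)"
proof -
  obtain B where B: "0 \<notin> B" "B \<subseteq> V" "pairwise orthogonal B" "\<And>x. x \<in> B \<Longrightarrow> norm x = 1"
      "independent B" "span B = V"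
    using orthonormal_basis_subspace[OF V] by (metis norm_zero zero_neq_one)
  have fin: "finite B"
    using B(5) by (rule independent_imp_finite)
  have f0: "f 0 = 0"
    using scale[of 0 0] subspace_0[OF V] by simp
  define y where "y = (\<Sum>b\<in>B. f b *\<^sub>R b)"
  have yV: "y \<in> V"
    unfolding y_def using B(2) by (intro subspace_sum[OF V] subspace_mul[OF V]) auto
  have fsum: "f (\<Sum>b\<in>F. c b *\<^sub>R b) = (\<Sum>b\<in>F. c b * f b)" if "F \<subseteq> B" for F c
    using finite_subset[OF that fin] that
  proof (induction F rule: finite_induct)
    case (insert b F)
    have "(\<Sum>b\<in>F. c b *\<^sub>R b) \<in> V" "b \<in> V"
      using insert.prems B(2) by (auto intro!: subspace_sum[OF V] subspace_mul[OF V])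
    then show ?case
      using insert by (simp add: add scale subspace_mul[OF V])
  qed (simp add: f0)
  have yf: "y \<bullet> x = f x" if "x \<in> V" for x
  proof -
    have "x \<in> span B"
      using that B(6) by simp
    then obtain c where c: "x = (\<Sum>b\<in>B. c b *\<^sub>R b)"
      using fin by (auto simp: span_finite)
    have "y \<bullet> b = f b" if b: "b \<in> B" for b
    proof -
      have "y \<bullet> b = (\<Sum>b'\<in>B. f b' * (b' \<bullet> b))"
        by (simp add: y_def inner_sum_left)
      also have "\<dots> = (\<Sum>b'\<in>B. if b' = b then f b else 0)"
      proof (rule sum.cong[OF refl])
        fix b' assume "b' \<in> B"
        then show "f b' * (b' \<bullet> b) = (if b' = b then f b else 0)"
          using b B(3) B(4)[OF b]
          by (auto simp: pairwise_def orthogonal_def dot_square_norm)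
      qed
      finally show ?thesis
        using fin b by simp
    qed
    then have "y \<bullet> x = (\<Sum>b\<in>B. c b * f b)"
      by (simp add: c inner_sum_right)
    with fsum[of B c] c show ?thesis
      by simp
  qed
  show ?thesis
  proof (rule ex1I[of _ "blinfun_inner_left y"])
    show "blinfun_inner_left y \<in> dual_space V \<and> (\<forall>x\<in>V. blinfun_apply (blinfun_inner_left y) x = f x)"
      using yV yf by (auto simp: dual_space_def orthogonal_def inner_commute)
  next
    fix \<phi> assume \<phi>: "\<phi> \<in> dual_space V \<and> (\<forall>x\<in>V. blinfun_apply \<phi> x = f x)"
    show "\<phi> = blinfun_inner_left y"
    proof (rule blinfun_eqI)
      fix x
      obtain u w where u: "u \<in> span V" and w: "\<And>v. v \<in> span V \<Longrightarrow> orthogonal w v" and x: "x = u + w"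
        using orthogonal_subspace_decomp_exists[of V x] by metis
      have uV: "u \<in> V"
        using u V by (metis span_eq_iff)
      have wV: "orthogonal v w" if "v \<in> V" for v
        using w[OF span_base[OF that]] by (simp add: orthogonal_commute)
      have "blinfun_apply \<phi> x = f u"
        using \<phi> uV wV by (simp add: x blinfun.add_right dual_space_def)
      moreover have "blinfun_apply (blinfun_inner_left y) x = f u"
        using yf[OF uV] wV[OF yV] by (simp add: x inner_add_left inner_add_right orthogonal_def inner_commute)
      ultimately show "blinfun_apply \<phi> x = blinfun_apply (blinfun_inner_left y) x"
        by simp
    qed
  qed
qed

definition polar_dual :: "(real ^ 'n) set \<Rightarrow> ((real ^ 'n) \<Rightarrow>\<^sub>L real) set" where
  "polar_dual P = {\<phi> \<in> dual_space (span P). \<forall>a \<in> P. blinfun_apply \<phi> a \<le> 1}"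

definition dual_lattice :: "(real ^ 'n) set \<Rightarrow> ((real ^ 'n) \<Rightarrow>\<^sub>L real) set" where
  "dual_lattice V =
     {\<phi> \<in> dual_space V. \<forall>a. real_vec a \<in> V \<longrightarrow> blinfun_apply \<phi> (real_vec a) \<in> \<int>}"

text \<open>The vertices of a polyhedron are its extreme points.\<close>

definition polar_dual_lattice_polyhedron :: "(real ^ 'n) set \<Rightarrow> bool" where
  "polar_dual_lattice_polyhedron P \<longleftrightarrow>
     (\<forall>\<phi>. \<phi> extreme_point_of polar_dual P \<longrightarrow> \<phi> \<in> dual_lattice (span P))"

end

theory Submission
  imports Defs
begin

text \<open>
  Let \<open>h\<^sub>P(a)\<close> be the least \<open>r \<ge> 0\<close> with \<open>a \<in> r P\<close>, and likewise \<open>h\<^sub>Q\<close>. A lattice point of the free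
  sum's cone is \<open>(a + b, k)\<close> with unique lattice points \<open>a\<close>, \<open>b\<close> of the two spans and
  \<open>h\<^sub>P(a) + h\<^sub>Q(b) \<le> k\<close>, whereas the right-hand side of the identity counts the pairs with
  \<open>\<lceil>h\<^sub>P(a)\<rceil> + \<lceil>h\<^sub>Q(b)\<rceil> \<le> k\<close>. If the dual of \<open>P\<close> has integral vertices then \<open>h\<^sub>P\<close>, a maximum of
  vertices of the dual, is integral at lattice points and the two conditions agree. Otherwise both
  gauges take non-integral values at lattice points, and passing to multiples one can make both
  fractional parts lie in \<open>(0, 1/2]\<close>, where \<open>\<lceil>h\<^sub>P(a) + h\<^sub>Q(b)\<rceil> < \<lceil>h\<^sub>P(a)\<rceil> + \<lceil>h\<^sub>Q(b)\<rceil>\<close>.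
\<close>

section \<open>Products of generating functions of filtrations\<close>

lemma lookup_sum_single:
  "Poly_Mapping.lookup (\<Sum>x\<in>A. Poly_Mapping.single x (1::int)) a = (if finite A \<and> a \<in> A then 1 else 0)"
  by (induction A rule: infinite_finite_induct) (auto simp: Poly_Mapping.lookup_add lookup_single when_def)

lemma sum_single_eq_iff:
  assumes "finite A" "finite B"
  shows "(\<Sum>x\<in>A. Poly_Mapping.single x (1::int)) = (\<Sum>x\<in>B. Poly_Mapping.single x 1) \<longleftrightarrow> A = B"
proof
  assume eq: "(\<Sum>x\<in>A. Poly_Mapping.single x (1::int)) = (\<Sum>x\<in>B. Poly_Mapping.single x 1)"
  show "A = B"
  proof (rule set_eqI)
    fix x show "x \<in> A \<longleftrightarrow> x \<in> B"
      using arg_cong[OF eq, of "\<lambda>p. Poly_Mapping.lookup p x"] assms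
      by (simp add: lookup_sum_single split: if_splits)
  qed
qed simp

text \<open>The factor \<open>1 - fps_X\<close> takes differences of consecutive coefficients, so
  each point survives only at the level where it first appears. Removing all lower levels rather
  than just the preceding one makes the formula cover level 0 too.\<close>

lemma fps_one_minus_X_mult_filtration:
  fixes A :: "nat \<Rightarrow> 'a::comm_monoid_add set"
  assumes fin: "\<And>k. finite (A k)" and "mono A"
  shows "(1 - fps_X) * Abs_fps (\<lambda>k. \<Sum>a\<in>A k. Poly_Mapping.single a (1::int)) =
    Abs_fps (\<lambda>k. \<Sum>a\<in>A k - (\<Union>j<k. A j). Poly_Mapping.single a 1)"
proof (rule fps_ext)
  fix k
  show "fps_nth ((1 - fps_X) * Abs_fps (\<lambda>k. \<Sum>a\<in>A k. Poly_Mapping.single a (1::int))) k =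
    fps_nth (Abs_fps (\<lambda>k. \<Sum>a\<in>A k - (\<Union>j<k. A j). Poly_Mapping.single a 1)) k"
  proof (cases k)
    case 0
    then show ?thesis by (simp add: algebra_simps)
  next
    case (Suc n)
    have "(\<Union>j<Suc n. A j) = A n"
      using \<open>mono A\<close> by (fastforce simp: mono_def less_Suc_eq_le)
    moreover have "A n \<subseteq> A (Suc n)"
      using \<open>mono A\<close> by (simp add: mono_def)
    ultimately show ?thesis
      using Suc fin by (simp add: left_diff_distrib sum_diff)
  qed
qed

text \<open>Without the factor \<open>1 - fps_X\<close> a pair \<open>(a, b)\<close> would be
  counted once for every admissible \<open>i\<close>. Absorbing the factor into \<open>A\<close>
  leaves \<open>a\<close> in a single level, and unique decomposition of sums then makes every
  coefficient 0 or 1.\<close>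

lemma fps_filtration_mult:
  fixes A B :: "nat \<Rightarrow> 'a::comm_monoid_add set"
  assumes finA: "\<And>k. finite (A k)" and finB: "\<And>k. finite (B k)"
    and "mono A" and "mono B"
    and inj: "\<And>i j a a' b b'. a \<in> A i \<Longrightarrow> a' \<in> A i \<Longrightarrow> b \<in> B j \<Longrightarrow> b' \<in> B j \<Longrightarrow>
      a + b = a' + b' \<Longrightarrow> a = a' \<and> b = b'"
  shows "(1 - fps_X) * Abs_fps (\<lambda>k. \<Sum>a\<in>A k. Poly_Mapping.single a (1::int))
      * Abs_fps (\<lambda>k. \<Sum>b\<in>B k. Poly_Mapping.single b 1) =
    Abs_fps (\<lambda>k. \<Sum>c\<in>{a + b | i a b. i \<le> k \<and> a \<in> A i \<and> b \<in> B (k - i)}. Poly_Mapping.single c 1)"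
    (is "_ = Abs_fps (\<lambda>k. \<Sum>c\<in>?C k. _)")
proof (rule fps_ext)
  fix k
  define A' where "A' i = A i - (\<Union>j<i. A j)" for i
  define S where "S = (SIGMA i:{0..k}. A' i \<times> B (k - i))"
  have monoA: "A i \<subseteq> A j" and monoB: "B i \<subseteq> B j" if "i \<le> j" for i j
    using \<open>mono A\<close> \<open>mono B\<close> that by (auto simp: mono_def)
  have disj: "i = j" if "a \<in> A' i" "a \<in> A' j" for i j a
    using that by (cases i j rule: linorder_cases) (auto simp: A'_def)
  have inj_S: "inj_on (\<lambda>(i, a, b). a + b) S"
  proof (rule inj_onI, clarsimp simp: S_def)
    fix i a b i' a' b'
    assume *: "i \<le> k" "a \<in> A' i" "b \<in> B (k - i)" "i' \<le> k" "a' \<in> A' i'" "b' \<in> B (k - i')" "a + b = a' + b'"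
    have "a \<in> A k" "a' \<in> A k" "b \<in> B k" "b' \<in> B k"
      using * monoA[of i k] monoA[of i' k] monoB[of "k - i" k] monoB[of "k - i'" k] by (auto simp: A'_def)
    then have "a = a' \<and> b = b'" using inj *(7) by blast
    with disj * show "i = i' \<and> a = a' \<and> b = b'" by blast
  qed
  have image_S: "(\<lambda>(i, a, b). a + b) ` S = ?C k"
  proof
    show "(\<lambda>(i, a, b). a + b) ` S \<subseteq> ?C k"
      by (force simp: S_def A'_def)
  next
    show "?C k \<subseteq> (\<lambda>(i, a, b). a + b) ` S"
    proof clarify
      fix i a b assume i: "i \<le> k" and a: "a \<in> A i" and b: "b \<in> B (k - i)"
      \<comment> \<open>Replacing \<open>i\<close> by the first level of \<open>a\<close> only
        enlarges \<open>k - i\<close>, so \<open>b\<close> remains admissible by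
        monotonicity.\<close>
      define l where "l = (LEAST l. a \<in> A l)"
      have "a \<in> A l" "l \<le> i"
        using a by (auto simp: l_def intro: LeastI Least_le)
      moreover have "a \<notin> A j" if "j < l" for j
        using that not_less_Least unfolding l_def by blast
      moreover have "b \<in> B (k - l)"
        using b monoB[of "k - i" "k - l"] \<open>l \<le> i\<close> by (auto simp: diff_le_mono2)
      ultimately have "(l, a, b) \<in> S"
        using i unfolding S_def A'_def by simp
      then show "a + b \<in> (\<lambda>(i, a, b). a + b) ` S"
        by (rule rev_image_eqI) simp
    qed
  qed
  have fin': "finite (A' i)" for i
    using finA by (simp add: A'_def)
  have "fps_nth ((1 - fps_X) * Abs_fps (\<lambda>k. \<Sum>a\<in>A k. Poly_Mapping.single a (1::int))
      * Abs_fps (\<lambda>k. \<Sum>b\<in>B k. Poly_Mapping.single b 1)) k =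
    (\<Sum>i=0..k. (\<Sum>a\<in>A' i. Poly_Mapping.single a 1) * (\<Sum>b\<in>B (k - i). Poly_Mapping.single b 1))"
    using finA \<open>mono A\<close> by (simp add: fps_one_minus_X_mult_filtration fps_mult_nth A'_def)
  also have "\<dots> = (\<Sum>i=0..k. \<Sum>(a, b)\<in>A' i \<times> B (k - i). Poly_Mapping.single (a + b) 1)"
    by (simp add: sum_product sum.cartesian_product mult_single)
  also have "\<dots> = (\<Sum>(i, a, b)\<in>S. Poly_Mapping.single (a + b) 1)"
    using fin' finB unfolding S_def by (subst sum.Sigma) (auto simp: case_prod_unfold)
  also have "\<dots> = (\<Sum>c\<in>(\<lambda>(i, a, b). a + b) ` S. Poly_Mapping.single c 1)"
    by (subst sum.reindex[OF inj_S]) (simp add: case_prod_unfold)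
  finally show "fps_nth ((1 - fps_X) * Abs_fps (\<lambda>k. \<Sum>a\<in>A k. Poly_Mapping.single a (1::int))
      * Abs_fps (\<lambda>k. \<Sum>b\<in>B k. Poly_Mapping.single b 1)) k =
      fps_nth (Abs_fps (\<lambda>k. \<Sum>c\<in>?C k. Poly_Mapping.single c 1)) k"
    by (simp add: image_S)
qed

section \<open>Cones over free sums\<close>

lemma cone_over_iff: "(x, r) \<in> cone_over K \<longleftrightarrow> 0 \<le> r \<and> (\<exists>a\<in>K. x = r *\<^sub>R a)"
  by (auto simp: cone_over_def)

lemma cone_over_eq_conic_hull: "cone_over K = conic hull (K \<times> {1})"
  by (auto simp: cone_over_def conic_hull_explicit)

text \<open>If \<open>x\<close> is \<open>r\<close> times \<open>a\<close>, it is also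
  \<open>s\<close> times a point on the segment from 0 to \<open>a\<close>.\<close>

lemma cone_over_mono:
  assumes K: "convex K" "0 \<in> K" and x: "(x, r) \<in> cone_over K" and "r \<le> s"
  shows "(x, s) \<in> cone_over K"
proof (cases "s = 0")
  case False
  obtain a where a: "a \<in> K" "x = r *\<^sub>R a" and r: "0 \<le> r"
    using x by (auto simp: cone_over_iff)
  have "(r / s) *\<^sub>R a + (1 - r / s) *\<^sub>R 0 \<in> K"
    using K a r \<open>r \<le> s\<close> False by (intro convexD) auto
  then show ?thesis
    using a r \<open>r \<le> s\<close> False by (auto simp: cone_over_iff intro!: bexI[of _ "(r / s) *\<^sub>R a"])
qed (use assms in \<open>auto simp: cone_over_iff\<close>)

text \<open>A point of the hull is a convex combination of one point of \<open>P\<close> and one of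
  \<open>Q\<close>; multiplying its weights by \<open>k\<close> gives the two heights, and dividing
  the heights by \<open>k\<close> recovers the weights.\<close>

lemma cone_over_conv_sum:
  assumes "convex P" "convex Q" "P \<noteq> {}" "Q \<noteq> {}"
  shows "(c, k) \<in> cone_over (conv_sum P Q) \<longleftrightarrow>
    (\<exists>a b r s. c = a + b \<and> k = r + s \<and> (a, r) \<in> cone_over P \<and> (b, s) \<in> cone_over Q)"
proof
  assume "(c, k) \<in> cone_over (conv_sum P Q)"
  then obtain x where k: "0 \<le> k" and x: "x \<in> convex hull (P \<union> Q)" and c: "c = k *\<^sub>R x"
    by (auto simp: cone_over_iff conv_sum_def)
  from x obtain u v p q where upq: "0 \<le> u" "0 \<le> v" "u + v = 1" "p \<in> P" "q \<in> Q" "x = u *\<^sub>R p + v *\<^sub>R q"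
    unfolding convex_hull_union_two[OF assms(1,3,2,4)] by blast
  show "\<exists>a b r s. c = a + b \<and> k = r + s \<and> (a, r) \<in> cone_over P \<and> (b, s) \<in> cone_over Q"
    using upq k c
    by (intro exI[of _ "(k * u) *\<^sub>R p"] exI[of _ "(k * v) *\<^sub>R q"] exI[of _ "k * u"] exI[of _ "k * v"])
      (auto simp: cone_over_iff scaleR_add_right simp flip: distrib_left)
next
  assume "\<exists>a b r s. c = a + b \<and> k = r + s \<and> (a, r) \<in> cone_over P \<and> (b, s) \<in> cone_over Q"
  then obtain r s p q where *: "k = r + s" "0 \<le> r" "0 \<le> s" "p \<in> P" "q \<in> Q" "c = r *\<^sub>R p + s *\<^sub>R q"
    by (auto simp: cone_over_iff)
  have pq: "p \<in> convex hull (P \<union> Q)" "q \<in> convex hull (P \<union> Q)"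
    using * by (auto intro: hull_inc)
  show "(c, k) \<in> cone_over (conv_sum P Q)"
  \<comment> \<open>At the apex the heights cannot be normalised, but there \<open>r = s = 0\<close>
    and \<open>c = 0\<close>.\<close>
  proof (cases "k = 0")
    case True
    then show ?thesis
      using * pq by (auto simp: cone_over_iff conv_sum_def add_nonneg_eq_0_iff)
  next
    case False
    have "(r / k) *\<^sub>R p + (s / k) *\<^sub>R q \<in> convex hull (P \<union> Q)"
      using * pq False by (intro convexD[OF convex_convex_hull]) (auto simp flip: add_divide_distrib)
    then show ?thesis
      using * False by (auto simp: cone_over_iff conv_sum_def scaleR_add_right
        intro!: bexI[of _ "(r / k) *\<^sub>R p + (s / k) *\<^sub>R q"])
  qed
qed

lemma cone_over_conv_sumI:
  assumes "convex P" "convex Q" "(a, r) \<in> cone_over P" "(b, s) \<in> cone_over Q"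
  shows "(a + b, r + s) \<in> cone_over (conv_sum P Q)"
proof -
  have "P \<noteq> {}" "Q \<noteq> {}"
    using assms(3,4) by (auto simp: cone_over_iff)
  then show ?thesis
    using assms cone_over_conv_sum by blast
qed

lemma cone_over_add:
  assumes "convex K" "(x, r) \<in> cone_over K" "(y, s) \<in> cone_over K"
  shows "(x + y, r + s) \<in> cone_over K"
proof -
  have "K \<noteq> {}"
    using assms(2) by (auto simp: cone_over_iff)
  moreover have "conv_sum K K = K"
    using assms(1) by (simp add: conv_sum_def hull_same)
  ultimately show ?thesis
    using cone_over_conv_sum[of K K "x + y" "r + s"] assms by auto
qed

lemma cone_over_scale:
  assumes "(x, r) \<in> cone_over K" "0 \<le> c"
  shows "(c *\<^sub>R x, c * r) \<in> cone_over K"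
  using assms by (auto simp: cone_over_iff)

lemma cone_over_sum:
  assumes "convex K" "A \<subseteq> K" "finite A" "K \<noteq> {}" "\<And>v. v \<in> A \<Longrightarrow> 0 \<le> d v"
  shows "(\<Sum>v\<in>A. d v *\<^sub>R v, \<Sum>v\<in>A. d v) \<in> cone_over K"
  using assms(3,2,5)
proof (induction A rule: finite_induct)
  case empty
  then show ?case using \<open>K \<noteq> {}\<close> by (auto simp: cone_over_iff)
next
  case (insert v F)
  have "(d v *\<^sub>R v, d v) \<in> cone_over K"
    using insert.prems by (auto simp: cone_over_iff)
  with insert show ?case
    by (auto intro!: cone_over_add[OF assms(1)])
qed

lemma cone_over_in_span: "(x, r) \<in> cone_over K \<Longrightarrow> x \<in> span K"
  by (auto simp: cone_over_iff intro: span_mul span_base)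

section \<open>Vertices of polar duals\<close>

lemma span_convex_hull: "span (convex hull E) = span E"
  by (metis convex_hull_subset_span hull_subset span_mono span_span subset_antisym)

lemma blinfun_le_convex_hull:
  fixes \<phi> :: "'a::real_normed_vector \<Rightarrow>\<^sub>L real"
  assumes "\<And>v. v \<in> E \<Longrightarrow> blinfun_apply \<phi> v \<le> c" and "p \<in> convex hull E"
  shows "blinfun_apply \<phi> p \<le> c"
proof -
  have "convex (blinfun_apply \<phi> -` {..c})"
    by (intro convex_linear_vimage) (auto intro: blinfun.bounded_linear_right bounded_linear.linear)
  then have "convex hull E \<subseteq> blinfun_apply \<phi> -` {..c}"
    using assms(1) by (intro hull_minimal) auto
  then show ?thesis using assms(2) by auto
qed

lemma blinfun_eq_on_span:
  fixes \<phi> \<psi> :: "'a::real_normed_vector \<Rightarrow>\<^sub>L real"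
  assumes "\<And>v. v \<in> A \<Longrightarrow> blinfun_apply \<phi> v = blinfun_apply \<psi> v" and "x \<in> span A"
  shows "blinfun_apply \<phi> x = blinfun_apply \<psi> x"
  using linear_eq_on_span[of "blinfun_apply \<phi>" "blinfun_apply \<psi>" A x] assms
  by (auto simp: blinfun.bounded_linear_right bounded_linear.linear)

lemma dual_space_inner: "w \<in> V \<Longrightarrow> blinfun_inner_left w \<in> dual_space V"
  by (auto simp: dual_space_def orthogonal_def inner_commute)

lemma dual_space_add: "\<phi> \<in> dual_space V \<Longrightarrow> \<psi> \<in> dual_space V \<Longrightarrow> \<phi> + \<psi> \<in> dual_space V"
  by (simp add: dual_space_def blinfun.add_left)

lemma dual_space_scale: "\<phi> \<in> dual_space V \<Longrightarrow> c *\<^sub>R \<phi> \<in> dual_space V"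
  by (simp add: dual_space_def blinfun.scaleR_left)

lemma dual_space_eqI:
  fixes V :: "(real ^ 'n) set"
  assumes "subspace V" "\<phi> \<in> dual_space V" "\<psi> \<in> dual_space V"
    and "\<And>x. x \<in> V \<Longrightarrow> blinfun_apply \<phi> x = blinfun_apply \<psi> x"
  shows "\<phi> = \<psi>"
  using dual_space_extension[OF assms(1), of "blinfun_apply \<phi>"] assms(2-4)
  by (auto simp: blinfun.add_right blinfun.scaleR_right)

lemma polar_dual_convex_hull:
  "\<phi> \<in> polar_dual (convex hull E) \<longleftrightarrow> \<phi> \<in> dual_space (span E) \<and> (\<forall>v\<in>E. blinfun_apply \<phi> v \<le> 1)"
  unfolding polar_dual_def span_convex_hull using blinfun_le_convex_hull[of E \<phi> 1] hull_inc[of _ E convex] by blast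

section \<open>Extreme points of the polar dual and their active constraints\<close>

text \<open>Where a proper convex combination of two functionals bounded by 1 equals 1, both equal
  1. The endpoints of a segment around \<phi> thus agree on the active points, hence on the span of
  \<open>P\<close>, which determines an element of the dual space.\<close>

lemma extreme_point_of_polar_dual_if_active_span:
  assumes \<phi>: "\<phi> \<in> polar_dual P" and span: "P \<subseteq> span {v \<in> P. blinfun_apply \<phi> v = 1}"
  shows "\<phi> extreme_point_of polar_dual P"
  unfolding extreme_point_of_def
proof (intro conjI \<phi> ballI notI)
  fix \<alpha> \<beta> assume \<alpha>: "\<alpha> \<in> polar_dual P" and \<beta>: "\<beta> \<in> polar_dual P" and "\<phi> \<in> open_segment \<alpha> \<beta>"
  then obtain u where ne: "\<alpha> \<noteq> \<beta>" and u: "0 < u" "u < 1" "\<phi> = (1 - u) *\<^sub>R \<alpha> + u *\<^sub>R \<beta>"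
    by (auto simp: in_segment)
  have "blinfun_apply \<alpha> v = blinfun_apply \<beta> v" if "v \<in> {v \<in> P. blinfun_apply \<phi> v = 1}" for v
  proof -
    have eq: "(1 - u) * blinfun_apply \<alpha> v + u * blinfun_apply \<beta> v = 1"
      using that by (simp add: u blinfun.add_left blinfun.scaleR_left)
    have le: "blinfun_apply \<alpha> v \<le> 1" "blinfun_apply \<beta> v \<le> 1"
      using \<alpha> \<beta> that by (auto simp: polar_dual_def)
    have "(1 - u) * (1 - blinfun_apply \<alpha> v) + u * (1 - blinfun_apply \<beta> v) = 0"
      using eq by (simp add: algebra_simps)
    then show ?thesis
      using u le by (simp add: add_nonneg_eq_0_iff)
  qed
  then have "blinfun_apply \<alpha> x = blinfun_apply \<beta> x" if "x \<in> span P" for x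
    using blinfun_eq_on_span that span_minimal[OF span subspace_span] by blast
  then have "\<alpha> = \<beta>"
    using \<alpha> \<beta> by (intro dual_space_eqI[of "span P"]) (auto simp: polar_dual_def)
  with ne show False by simp
qed

text \<open>If the active constraints do not span, \<phi> can be moved both ways along a direction
  \<open>w\<close> orthogonal to them, so it is the midpoint of a segment in the polar dual.\<close>

lemma active_span_if_extreme_point_of_polar_dual:
  assumes "finite E" and ext: "\<phi> extreme_point_of polar_dual (convex hull E)"
  shows "E \<subseteq> span {v \<in> E. blinfun_apply \<phi> v = 1}" (is "_ \<subseteq> span ?A")
proof (rule ccontr)
  assume "\<not> E \<subseteq> span ?A"
  then have "span ?A \<subset> span E"
    by (metis (no_types, lifting) mem_Collect_eq psubsetI span_mono span_superset subsetI)
  then obtain w where w: "w \<noteq> 0" "w \<in> span E" "\<And>y. y \<in> span ?A \<Longrightarrow> orthogonal w y"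
    using orthogonal_to_subspace_exists_gen by blast
  have \<phi>: "\<phi> \<in> dual_space (span E)" "\<And>v. v \<in> E \<Longrightarrow> blinfun_apply \<phi> v \<le> 1"
    using ext by (auto simp: extreme_point_of_def polar_dual_convex_hull)
  \<comment> \<open>The absolute value treats both directions at once. Active constraints do not
    change along \<open>w\<close>, and the finitely many others have positive slack.\<close>
  have "\<forall>\<^sub>F t in at_right 0. \<forall>v\<in>E. t * \<bar>w \<bullet> v\<bar> \<le> 1 - blinfun_apply \<phi> v"
  proof (intro eventually_ball_finite[OF \<open>finite E\<close>] ballI)
    fix v assume "v \<in> E"
    show "\<forall>\<^sub>F t in at_right 0. t * \<bar>w \<bullet> v\<bar> \<le> 1 - blinfun_apply \<phi> v"
    proof (cases "blinfun_apply \<phi> v = 1")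
      case True
      then have "w \<bullet> v = 0" using w(3) \<open>v \<in> E\<close> by (auto simp: orthogonal_def intro: span_base)
      then show ?thesis using True by simp
    next
      case False
      have "((\<lambda>t. t * \<bar>w \<bullet> v\<bar>) \<longlongrightarrow> 0 * \<bar>w \<bullet> v\<bar>) (at_right 0)"
        by (intro tendsto_intros)
      then have "\<forall>\<^sub>F t in at_right 0. t * \<bar>w \<bullet> v\<bar> < 1 - blinfun_apply \<phi> v"
        by (rule order_tendstoD) (use False \<phi>(2)[OF \<open>v \<in> E\<close>] in auto)
      then show ?thesis by eventually_elim simp
    qed
  qed
  moreover have "\<forall>\<^sub>F t in at_right (0::real). 0 < t"
    by (rule eventually_at_right_less)
  ultimately obtain t where t: "0 < t" "\<And>v. v \<in> E \<Longrightarrow> t * \<bar>w \<bullet> v\<bar> \<le> 1 - blinfun_apply \<phi> v"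
    using eventually_happens'[OF trivial_limit_at_right_real eventually_conj] by blast
  have mem: "\<phi> + c *\<^sub>R blinfun_inner_left w \<in> polar_dual (convex hull E)" if "\<bar>c\<bar> = t" for c
  proof -
    have "blinfun_apply \<phi> v + c * (w \<bullet> v) \<le> 1" if "v \<in> E" for v
      using t(2)[OF that] abs_ge_self[of "c * (w \<bullet> v)"] \<open>\<bar>c\<bar> = t\<close> by (simp add: abs_mult)
    then show ?thesis
      using \<phi>(1) w(2) by (auto simp: polar_dual_convex_hull blinfun.add_left blinfun.scaleR_left inner_commute
        intro!: dual_space_add dual_space_scale dual_space_inner)
  qed
  have "\<phi> \<in> open_segment (\<phi> + (-t) *\<^sub>R blinfun_inner_left w) (\<phi> + t *\<^sub>R blinfun_inner_left w)"
    unfolding in_segment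
  proof (intro conjI exI[of _ "1/2"])
    \<comment> \<open>The two endpoints differ at \<open>w\<close> itself, where their values are
      \<open>2 * t * (w \<bullet> w)\<close> apart.\<close>
    show "\<phi> + (-t) *\<^sub>R blinfun_inner_left w \<noteq> \<phi> + t *\<^sub>R blinfun_inner_left w"
    proof
      assume "\<phi> + (-t) *\<^sub>R blinfun_inner_left w = \<phi> + t *\<^sub>R blinfun_inner_left w"
      from arg_cong[OF this, of "\<lambda>\<psi>. blinfun_apply \<psi> w"] show False
        using t(1) w(1) by (simp add: blinfun.add_left blinfun.diff_left blinfun.scaleR_left)
    qed
    show "\<phi> = (1 - 1/2) *\<^sub>R (\<phi> + (-t) *\<^sub>R blinfun_inner_left w) + (1/2) *\<^sub>R (\<phi> + t *\<^sub>R blinfun_inner_left w)"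
      by (rule blinfun_eqI) (simp add: blinfun.add_left blinfun.scaleR_left blinfun.minus_left field_simps)
  qed auto
  with ext mem[of t] mem[of "-t"] t(1) show False
    by (auto simp: extreme_point_of_def)
qed

text \<open>
  A simplex-type pivoting argument: as long as the constraints active at \<open>\<phi>\<close> do not span, \<open>\<phi>\<close> can be
  moved along a direction orthogonal to them, without decreasing its value at \<open>x\<close>, until a further
  constraint becomes active. The polyhedron need not be bounded, but the objective \<open>x\<close> lies in the
  cone of the constraints, so the movement does stop.
\<close>

lemma extreme_point_of_polar_dual_ge:
  assumes "finite E" and "\<phi> \<in> polar_dual (convex hull E)" and x: "(x, r) \<in> cone_over (convex hull E)"
  shows "\<exists>\<psi>. \<psi> extreme_point_of polar_dual (convex hull E) \<and> blinfun_apply \<phi> x \<le> blinfun_apply \<psi> x"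
  using assms(2)
proof (induction "card {v \<in> E. blinfun_apply \<phi> v \<noteq> 1}" arbitrary: \<phi> rule: less_induct)
  case less
  note \<phi> = less.prems[unfolded polar_dual_convex_hull]
  let ?A = "{v \<in> E. blinfun_apply \<phi> v = 1}"
  show ?case
  proof (cases "E \<subseteq> span ?A")
    case True
    have "?A \<subseteq> {v \<in> convex hull E. blinfun_apply \<phi> v = 1}"
      by (auto intro: hull_inc)
    then have "convex hull E \<subseteq> span {v \<in> convex hull E. blinfun_apply \<phi> v = 1}"
      using True by (meson hull_minimal span_mono subset_trans subspace_imp_convex subspace_span)
    then show ?thesis
      using extreme_point_of_polar_dual_if_active_span[OF less.prems] by blast
  next
    case False
    then have "span ?A \<subset> span E"
      by (metis (no_types, lifting) mem_Collect_eq psubsetI span_mono span_superset subsetI)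
    then obtain w where w: "w \<noteq> 0" "w \<in> span E" "\<And>y. y \<in> span ?A \<Longrightarrow> orthogonal w y"
      using orthogonal_to_subspace_exists_gen by blast
    have le0: "u \<bullet> x \<le> 0" if "\<And>v. v \<in> E \<Longrightarrow> u \<bullet> v \<le> 0" for u
    proof -
      obtain p where "p \<in> convex hull E" "x = r *\<^sub>R p" "0 \<le> r"
        using x by (auto simp: cone_over_iff)
      then show ?thesis
        using blinfun_le_convex_hull[of E "blinfun_inner_left u" 0] that
        by (simp add: inner_commute mult_nonneg_nonpos)
    qed
    have "\<exists>v\<in>E. w \<bullet> v \<noteq> 0"
      using w(1,2) orthogonal_to_span[of w E w] by (auto simp: orthogonal_def)
    \<comment> \<open>If \<open>w \<bullet> x\<close> is nonzero, \<open>le0\<close> supplies a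
      blocking constraint for the sign that increases the value at \<open>x\<close>. If it is zero,
      either sign is harmless and the nonzero product with some \<open>v\<close> selects
      one.\<close>
    then have "(\<exists>v\<in>E. 0 < w \<bullet> v) \<and> 0 \<le> w \<bullet> x \<or> (\<exists>v\<in>E. 0 < (-w) \<bullet> v) \<and> 0 \<le> (-w) \<bullet> x"
      using le0[of w] le0[of "-w"] by (smt (verit) inner_minus_left)
    then obtain u where u: "\<exists>v\<in>E. 0 < u \<bullet> v" "0 \<le> u \<bullet> x" "u \<in> span E" "\<And>y. y \<in> ?A \<Longrightarrow> u \<bullet> y = 0"
    proof (elim disjE conjE, goal_cases)
      case 1
      then show ?case
        using that[of w] w(2,3) by (simp add: orthogonal_def span_base)
    next
      case 2
      then show ?case
        using that[of "-w"] w(2,3) by (simp add: orthogonal_def span_base span_neg)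
    qed
    define E' where "E' = {v \<in> E. 0 < u \<bullet> v}"
    \<comment> \<open>The ratio test: the first time at which a constraint becomes active when
      moving along \<open>u\<close>.\<close>
    define t where "t = Min ((\<lambda>v. (1 - blinfun_apply \<phi> v) / (u \<bullet> v)) ` E')"
    have E': "finite E'" "E' \<noteq> {}"
      using \<open>finite E\<close> u(1) by (auto simp: E'_def)
    then obtain v0 where v0: "v0 \<in> E'" "t = (1 - blinfun_apply \<phi> v0) / (u \<bullet> v0)"
      using that Min_in[of "(\<lambda>v. (1 - blinfun_apply \<phi> v) / (u \<bullet> v)) ` E'"]
      unfolding t_def[symmetric] by auto
    have t_le: "t \<le> (1 - blinfun_apply \<phi> v) / (u \<bullet> v)" if "v \<in> E'" for v
      unfolding t_def using E' that by simp
    have "0 \<le> t"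
      using v0 \<phi> by (auto simp: E'_def)
    define \<phi>' where "\<phi>' = \<phi> + t *\<^sub>R blinfun_inner_left u"
    have \<phi>': "blinfun_apply \<phi>' y = blinfun_apply \<phi> y + t * (u \<bullet> y)" for y
      by (simp add: \<phi>'_def blinfun.add_left blinfun.scaleR_left inner_commute)
    have "blinfun_apply \<phi>' v \<le> 1" if "v \<in> E" for v
    proof (cases "v \<in> E'")
      case True
      then show ?thesis
        using t_le[OF True] by (simp add: \<phi>' E'_def field_simps)
    next
      case False
      then have "t * (u \<bullet> v) \<le> 0"
        using \<open>0 \<le> t\<close> that by (simp add: E'_def mult_nonneg_nonpos)
      then show ?thesis
        using \<phi> that by (force simp: \<phi>')
    qed
    then have "\<phi>' \<in> polar_dual (convex hull E)"
      using \<phi> u(3) by (auto simp: polar_dual_convex_hull \<phi>'_def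
        intro!: dual_space_add dual_space_scale dual_space_inner)
    \<comment> \<open>Since \<open>u\<close> vanishes on the active points they stay active, and
      \<open>v0\<close> joins them, so the induction measure drops.\<close>
    moreover have "{v \<in> E. blinfun_apply \<phi>' v \<noteq> 1} \<subset> {v \<in> E. blinfun_apply \<phi> v \<noteq> 1}"
    proof (rule psubsetI)
      show "{v \<in> E. blinfun_apply \<phi>' v \<noteq> 1} \<subseteq> {v \<in> E. blinfun_apply \<phi> v \<noteq> 1}"
        using u(4) by (auto simp: \<phi>')
      have "v0 \<in> {v \<in> E. blinfun_apply \<phi> v \<noteq> 1}" "blinfun_apply \<phi>' v0 = 1"
        using v0 u(4)[of v0] by (auto simp: E'_def \<phi>')
      then show "{v \<in> E. blinfun_apply \<phi>' v \<noteq> 1} \<noteq> {v \<in> E. blinfun_apply \<phi> v \<noteq> 1}"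
        by blast
    qed
    ultimately obtain \<psi> where "\<psi> extreme_point_of polar_dual (convex hull E)" "blinfun_apply \<phi>' x \<le> blinfun_apply \<psi> x"
      using less.hyps[of \<phi>'] psubset_card_mono[of "{v \<in> E. blinfun_apply \<phi> v \<noteq> 1}"] \<open>finite E\<close>
      by auto
    moreover have "blinfun_apply \<phi> x \<le> blinfun_apply \<phi>' x"
      using \<open>0 \<le> t\<close> u(2) by (simp add: \<phi>')
    ultimately show ?thesis by force
  qed
qed

section \<open>Duality between the cone and the polar dual\<close>

lemma polar_dual_le:
  assumes "\<phi> \<in> polar_dual P" "(x, r) \<in> cone_over P"
  shows "blinfun_apply \<phi> x \<le> r"
proof -
  obtain p where "p \<in> P" "x = r *\<^sub>R p" "0 \<le> r"
    using assms(2) by (auto simp: cone_over_iff)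
  then show ?thesis
    using assms(1) by (simp add: polar_dual_def blinfun.scaleR_right mult_left_le)
qed

text \<open>A hyperplane separating \<open>(x, s)\<close> from the closed convex cone has a normal
  \<open>(u, t)\<close>; rescaling \<open>u\<close> by a negative factor turns it into an element of
  the polar dual.\<close>

lemma polar_dual_gt_if_not_in_cone_over:
  assumes P: "compact P" "convex P" "0 \<in> P" and x: "x \<in> span P" "(x, s) \<notin> cone_over P" and s: "0 \<le> s"
  shows "\<exists>\<phi>\<in>polar_dual P. s < blinfun_apply \<phi> x"
proof -
  \<comment> \<open>Closedness holds because the compact base sits at height 1 and so misses the
    origin.\<close>
  have "closed (cone_over P)" "convex (cone_over P)"
    unfolding cone_over_eq_conic_hull using P
    by (auto intro!: closed_conic_hull convex_conic_hull compact_Times convex_Times simp: zero_prod_def)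
  then obtain z b where z: "z \<bullet> (x, s) < b" "\<And>y. y \<in> cone_over P \<Longrightarrow> b < z \<bullet> y"
    using separating_hyperplane_closed_point x(2) by metis
  obtain u t where ut: "z = (u, t)" by (cases z)
  have sep: "b < u \<bullet> y + t * r" if "(y, r) \<in> cone_over P" for y r
    using z(2)[OF that] by (simp add: ut)
  have b: "b < 0"
    using sep[of 0 0] P(3) by (auto simp: cone_over_iff)
  \<comment> \<open>A negative value could be scaled within the cone down to \<open>b\<close>,
    contradicting strict separation.\<close>
  have nonneg: "0 \<le> u \<bullet> y + t * r" if "(y, r) \<in> cone_over P" for y r
  proof (rule ccontr)
    assume neg: "\<not> 0 \<le> u \<bullet> y + t * r"
    define c where "c = b / (u \<bullet> y + t * r)"
    have "0 \<le> c" using neg b by (simp add: c_def divide_nonpos_nonpos)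
    from sep[OF cone_over_scale[OF that this]] have "b < c * (u \<bullet> y + t * r)"
      by (simp add: algebra_simps)
    then show False using neg by (simp add: c_def)
  qed
  have "0 \<le> t"
    using nonneg[of 0 1] P(3) by (auto simp: cone_over_iff)
  \<comment> \<open>Since \<open>t\<close> may be 0, it is first made positive. The increase
    \<open>- b / (s + 1)\<close> keeps nonnegativity on the cone and raises the value at
    \<open>(x, s)\<close> by at most \<open>- b\<close>, so that value stays negative.\<close>
  define \<tau> where "\<tau> = t - b / (s + 1)"
  have \<tau>: "0 < \<tau>" "t \<le> \<tau>"
    using \<open>0 \<le> t\<close> divide_neg_pos[of b "s + 1"] b s by (auto simp: \<tau>_def)
  have "s / (s + 1) \<le> 1" using s by simp
  then have "b \<le> b * (s / (s + 1))" using b by (metis less_imp_le mult.right_neutral mult_left_mono_neg)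
  then have x_neg: "u \<bullet> x + \<tau> * s < 0"
    using z(1) by (simp add: ut \<tau>_def algebra_simps)
  define w where "w = (- 1 / \<tau>) *\<^sub>R u"
  obtain \<phi> where \<phi>: "\<phi> \<in> dual_space (span P)" "\<And>y. y \<in> span P \<Longrightarrow> blinfun_apply \<phi> y = w \<bullet> y"
    using dual_space_extension[OF subspace_span, of P "\<lambda>y. w \<bullet> y"] by (auto simp: inner_add_right)
  have "w \<bullet> p \<le> 1" if "p \<in> P" for p
    using nonneg[of p 1] that \<tau> by (auto simp: cone_over_iff w_def field_simps)
  then have "\<phi> \<in> polar_dual P"
    using \<phi> by (simp add: polar_dual_def span_base)
  moreover have "s < blinfun_apply \<phi> x"
    using x_neg \<tau> by (simp add: \<phi>(2) x(1) w_def field_simps)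
  ultimately show ?thesis by blast
qed

text \<open>Failure at the floor gives a functional exceeding it at the lattice point, hence a
  vertex of the dual that does so. The value of that vertex is an integer at most \<open>r\<close>,
  so it cannot exceed the floor.\<close>

lemma cone_over_floor:
  fixes E :: "(real ^ 'n) set"
  assumes "finite E" "0 \<in> convex hull E" "polar_dual_lattice_polyhedron (convex hull E)"
    and a: "(real_vec a, r) \<in> cone_over (convex hull E)"
  shows "(real_vec a, of_int \<lfloor>r\<rfloor>) \<in> cone_over (convex hull E)"
proof (rule ccontr)
  assume not: "(real_vec a, of_int \<lfloor>r\<rfloor>) \<notin> cone_over (convex hull E)"
  have "0 \<le> r" using a by (simp add: cone_over_iff)
  then obtain \<phi> where \<phi>: "\<phi> \<in> polar_dual (convex hull E)" "\<lfloor>r\<rfloor> < blinfun_apply \<phi> (real_vec a)"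
    using polar_dual_gt_if_not_in_cone_over[OF _ _ assms(2) cone_over_in_span[OF a] not] assms(1)
    by (auto simp: finite_imp_compact_convex_hull)
  obtain \<psi> where \<psi>: "\<psi> extreme_point_of polar_dual (convex hull E)"
      "blinfun_apply \<phi> (real_vec a) \<le> blinfun_apply \<psi> (real_vec a)"
    using extreme_point_of_polar_dual_ge[OF assms(1) \<phi>(1) a] by blast
  then have "\<psi> \<in> dual_lattice (span (convex hull E))"
    using assms(3) by (simp add: polar_dual_lattice_polyhedron_def)
  then obtain k where k: "blinfun_apply \<psi> (real_vec a) = of_int k"
    using cone_over_in_span[OF a] by (auto simp: dual_lattice_def Ints_def)
  have "of_int k \<le> r"
    using polar_dual_le[OF _ a, of \<psi>] \<psi>(1) k by (simp add: extreme_point_of_def)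
  then have "k \<le> \<lfloor>r\<rfloor>" by (simp add: le_floor_iff)
  with k \<psi>(2) \<phi>(2) show False by simp
qed

section \<open>Lattice points\<close>

lemma real_vecI: "(\<And>i. x $ i \<in> \<int>) \<Longrightarrow> \<exists>a. x = real_vec a"
  by (rule exI[of _ "\<chi> i. \<lfloor>x $ i\<rfloor>"]) (auto simp: real_vec_def vec_eq_iff)

lemma real_vec_in_Ints [simp]: "real_vec a $ i \<in> \<int>"
  by (simp add: real_vec_def)

lemma real_vec_add: "real_vec (a + b) = real_vec a + real_vec b"
  by (simp add: real_vec_def vec_eq_iff)

lemma real_vec_eq_iff [simp]: "real_vec a = real_vec b \<longleftrightarrow> a = b"
  by (simp add: real_vec_def vec_eq_iff)

lemma common_denominator:
  assumes "finite S" "S \<subseteq> (\<rat> :: real set)"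
  shows "\<exists>N>0. \<forall>x\<in>S. real N * x \<in> \<int>"
  using assms
proof (induction S rule: finite_induct)
  case empty
  then show ?case by (intro exI[of _ 1]) simp
next
  case (insert y S)
  then obtain N where N: "N > 0" "\<forall>x\<in>S. real N * x \<in> \<int>" by auto
  obtain p :: int and q :: nat where q: "q > 0" and y: "y = of_int p / real q"
    using insert.prems unfolding Rats_eq_int_div_nat by blast
  have "real (N * q) * x \<in> \<int>" if "x \<in> insert y S" for x
  proof (cases "x = y")
    case True
    then have "real (N * q) * x = real N * of_int p" using q by (simp add: True y)
    then show ?thesis by (metis Ints_mult Ints_of_int Ints_of_nat)
  next
    case False
    then have "real q * (real N * x) \<in> \<int>"
      using that N(2) by (metis Ints_mult Ints_of_nat insertE)
    then show ?thesis by (simp add: algebra_simps)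
  qed
  then show ?case using N(1) q by (intro exI[of _ "N * q"]) auto
qed

text \<open>
  Let \<open>\<phi>\<close> be non-integral at a lattice point \<open>e\<close>. For a large multiple \<open>f\<close> of the sum of the
  vertices active at \<open>\<phi>\<close>, both \<open>f\<close> and \<open>f + e\<close> are nonnegative combinations of active vertices,
  and \<open>\<phi>\<close> cannot be integral at both.
\<close>

lemma nonlattice_vertex_attained_nonint:
  fixes E :: "(real ^ 'n) set"
  assumes "finite E" and rat: "\<And>v i. v \<in> E \<Longrightarrow> v $ i \<in> \<rat>"
    and ext: "\<phi> extreme_point_of polar_dual (convex hull E)"
    and "\<phi> \<notin> dual_lattice (span (convex hull E))" and "E \<noteq> {}"
  shows "\<exists>a. (real_vec a, blinfun_apply \<phi> (real_vec a)) \<in> cone_over (convex hull E) \<and>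
    blinfun_apply \<phi> (real_vec a) \<notin> \<int>"
proof -
  define A where "A = {v \<in> E. blinfun_apply \<phi> v = 1}"
  have A: "finite A" "A \<subseteq> E" using \<open>finite E\<close> by (auto simp: A_def)
  have \<phi>: "\<phi> \<in> polar_dual (convex hull E)"
    using ext by (simp add: extreme_point_of_def)
  then obtain e where e: "real_vec e \<in> span E" "blinfun_apply \<phi> (real_vec e) \<notin> \<int>"
    using assms(4) unfolding dual_lattice_def polar_dual_def span_convex_hull by blast
  have "span E \<subseteq> span A"
    using active_span_if_extreme_point_of_polar_dual[OF \<open>finite E\<close> ext] by (simp add: A_def span_minimal)
  then obtain c where c: "real_vec e = (\<Sum>v\<in>A. c v *\<^sub>R v)"
    using e(1) span_finite[OF A(1)] by auto
  have in_cone: "(\<Sum>v\<in>A. d v *\<^sub>R v, blinfun_apply \<phi> (\<Sum>v\<in>A. d v *\<^sub>R v)) \<in> cone_over (convex hull E)"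
    if "\<And>v. v \<in> A \<Longrightarrow> 0 \<le> d v" for d
  proof -
    have "blinfun_apply \<phi> (\<Sum>v\<in>A. d v *\<^sub>R v) = (\<Sum>v\<in>A. d v)"
      by (simp add: blinfun.sum_right blinfun.scaleR_right A_def)
    moreover have "A \<subseteq> convex hull E" "convex hull E \<noteq> {}"
      using A \<open>E \<noteq> {}\<close> hull_subset[of E convex] by auto
    ultimately show ?thesis
      using cone_over_sum[OF convex_convex_hull _ A(1)] that by simp
  qed
  have "finite (\<Union>i. (\<lambda>v. v $ i) ` A)" "(\<Union>i. (\<lambda>v. v $ i) ` A) \<subseteq> \<rat>"
    using A rat by auto
  from common_denominator[OF this] obtain N
    where N: "N > 0" "\<And>v i. v \<in> A \<Longrightarrow> real N * v $ i \<in> \<int>"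
    by auto
  \<comment> \<open>In \<open>M\<close>, the factor \<open>N\<close> clears the denominators of the
    active points, and \<open>L\<close> makes \<open>M\<close> dominate every coefficient
    \<open>c v\<close>.\<close>
  define L where "L = nat \<lceil>\<Sum>v\<in>A. \<bar>c v\<bar>\<rceil>"
  define M where "M = real N * real L"
  have M: "\<bar>c v\<bar> \<le> M" if "v \<in> A" for v
  proof -
    have "\<bar>c v\<bar> \<le> (\<Sum>v\<in>A. \<bar>c v\<bar>)"
      using that A(1) by (intro member_le_sum) auto
    also have "\<dots> \<le> real L"
      unfolding L_def by (rule real_nat_ceiling_ge)
    also have "\<dots> \<le> M"
      using mult_right_mono[of 1 "real N" "real L"] N(1) by (simp add: M_def)
    finally show ?thesis .
  qed
  have "M * v $ i \<in> \<int>" if "v \<in> A" for v i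
  proof -
    have "M * v $ i = real L * (real N * v $ i)"
      by (simp add: M_def)
    then show ?thesis using N(2)[OF that] by (metis Ints_mult Ints_of_nat)
  qed
  then have "(\<Sum>v\<in>A. M *\<^sub>R v) $ i \<in> \<int>" for i
    unfolding sum_component vector_scaleR_component real_scaleR_def by (rule Ints_sum)
  then obtain f where f: "(\<Sum>v\<in>A. M *\<^sub>R v) = real_vec f"
    using real_vecI by blast
  have fe: "real_vec (f + e) = (\<Sum>v\<in>A. (M + c v) *\<^sub>R v)"
    by (simp add: real_vec_add c scaleR_add_left sum.distrib flip: f)
  have "0 \<le> M" by (simp add: M_def)
  then have f_in: "(real_vec f, blinfun_apply \<phi> (real_vec f)) \<in> cone_over (convex hull E)"
    using in_cone[of "\<lambda>_. M"] by (simp add: f)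
  have "0 \<le> M + c v" if "v \<in> A" for v
    using M[OF that] by linarith
  then have fe_in: "(real_vec (f + e), blinfun_apply \<phi> (real_vec (f + e))) \<in> cone_over (convex hull E)"
    using in_cone[of "\<lambda>v. M + c v"] by (simp add: fe)
  have "blinfun_apply \<phi> (real_vec e) = blinfun_apply \<phi> (real_vec (f + e)) - blinfun_apply \<phi> (real_vec f)"
    by (simp add: real_vec_add blinfun.add_right)
  then have "blinfun_apply \<phi> (real_vec f) \<notin> \<int> \<or> blinfun_apply \<phi> (real_vec (f + e)) \<notin> \<int>"
    using e(2) Ints_diff by metis
  then show ?thesis using f_in fe_in by blast
qed

text \<open>When \<open>frac x\<close> exceeds 1/2, successive multiples of \<open>x\<close> move
  down modulo 1 in steps \<open>d < 1 / 2\<close>, too short to jump over the interval from 0 to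
  1/2.\<close>

lemma nat_multiple_small_frac:
  assumes "(x::real) \<notin> \<int>"
  shows "\<exists>m k. of_int k < real m * x \<and> real m * x \<le> of_int k + 1 / 2"
proof (cases "frac x \<le> 1 / 2")
  case True
  then show ?thesis
    using assms frac_gt_0_iff[of x] by (intro exI[of _ 1] exI[of _ "\<lfloor>x\<rfloor>"]) (auto simp: frac_def)
next
  case False
  define d where "d = 1 - frac x"
  have d: "0 < d" "d < 1 / 2"
    using False frac_lt_1[of x] by (auto simp: d_def)
  \<comment> \<open>The least \<open>m\<close> with \<open>m * d\<close> at least 1/2; the overshoot
    is below \<open>d\<close>, so \<open>m * d\<close> stays under 1.\<close>
  define m where "m = nat \<lceil>1 / (2 * d)\<rceil>"
  have m: "1 / (2 * d) \<le> real m" "real m < 1 / (2 * d) + 1"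
    using d unfolding m_def by (simp_all add: real_nat_ceiling_ge) linarith
  then have md: "1 / 2 \<le> real m * d" "real m * d < 1"
    using d by (auto simp: field_simps)
  define k where "k = int m * (\<lfloor>x\<rfloor> + 1) - 1"
  have "real m * x = of_int k + (1 - real m * d)"
    by (simp add: k_def d_def frac_def algebra_simps)
  with md have "of_int k < real m * x" "real m * x \<le> of_int k + 1 / 2"
    by auto
  then show ?thesis by blast
qed

section \<open>Unimodular coordinates and the lattice splitting of a free sum\<close>

lemma Ints_det: "(\<And>i j. A $ i $ j \<in> \<int>) \<Longrightarrow> det (A :: real ^ 'n ^ 'n) \<in> \<int>"
  unfolding det_def by (intro Ints_sum Ints_mult Ints_prod) auto

text \<open>Cramer's rule with determinant 1 writes each coordinate of \<open>x\<close> as the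
  determinant of an integer matrix.\<close>

lemma SL_int_reflects_lattice:
  assumes g: "g \<in> SL_int" and "\<And>i. (g *v x) $ i \<in> \<int>"
  shows "x $ i \<in> \<int>"
proof -
  have "x = (\<chi> k. det (\<chi> i j. if j = k then (g *v x) $ i else g $ i $ j))"
    using cramer[of g x "g *v x"] g by (simp add: SL_int_def)
  from arg_cong[OF this, of "\<lambda>y. y $ i"]
  have "x $ i = det (\<chi> i' j. if j = i then (g *v x) $ i' else g $ i' $ j)"
    by (simp only: vec_lambda_beta)
  also have "\<dots> \<in> \<int>"
    using assms by (intro Ints_det) (auto simp: SL_int_def)
  finally show ?thesis .
qed

lemma SL_int_mult_eq_0:
  assumes "g \<in> SL_int" "g *v x = 0"
  shows "x = 0"
proof -
  have "invertible g"
    using assms(1) by (simp add: invertible_det_nz SL_int_def)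
  then obtain B where "B ** g = mat 1"
    by (auto simp: invertible_def)
  then have "x = B *v (g *v x)"
    by (simp add: matrix_vector_mul_assoc)
  then show ?thesis by (simp add: assms(2))
qed

text \<open>After applying \<open>g\<close>, the image of \<open>y\<close> vanishes in the
  coordinates in \<open>A\<close> by orthogonality, and that of \<open>x\<close> vanishes in all
  others. So every coordinate of \<open>g *v x\<close> is 0 or a coordinate of an integral
  vector.\<close>

lemma free_sum_lattice:
  fixes P Q :: "(real ^ 'n) set"
  assumes "free_sum P Q" "x \<in> span P" "y \<in> span Q" and xy: "x + y = real_vec c"
  shows "\<exists>a b. x = real_vec a \<and> y = real_vec b"
proof -
  obtain g A where g: "g \<in> SL_int" and A: "span ((*v) g ` P) = span ((\<lambda>i. axis i 1) ` A)"
    and orth: "\<And>x y. x \<in> span ((*v) g ` P) \<Longrightarrow> y \<in> span ((*v) g ` Q) \<Longrightarrow> orthogonal x y"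
    using assms(1) by (auto simp: free_sum_def coordinate_subspace_def)
  have gx: "g *v x \<in> span ((*v) g ` P)" and gy: "g *v y \<in> span ((*v) g ` Q)"
    using assms(2,3) by (auto simp: span_linear_image)
  have sum_int: "(g *v (x + y)) $ i \<in> \<int>" for i
    using g by (auto simp: xy matrix_vector_mult_def SL_int_def intro!: Ints_sum Ints_mult)
  have "(g *v x) $ i \<in> \<int>" for i
  proof (cases "i \<in> A")
    case True
    then have "axis i 1 \<in> span ((*v) g ` P)"
      unfolding A by (intro span_base) auto
    then have "(g *v y) $ i = 0"
      using orth[OF _ gy] by (force simp: orthogonal_def inner_axis')
    then show ?thesis using sum_int[of i] by (simp add: matrix_vector_right_distrib)
  next
    case False
    have "subspace {z :: real ^ 'n. z $ i = 0}"
      by (auto simp: subspace_def)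
    then have "span ((\<lambda>i. axis i 1) ` A) \<subseteq> {z :: real ^ 'n. z $ i = 0}"
      using False by (intro span_minimal) (auto simp: axis_def)
    then show ?thesis using gx A by auto
  qed
  then have x_int: "x $ i \<in> \<int>" for i
    using SL_int_reflects_lattice[OF g] by blast
  have "y $ i = real_vec c $ i - x $ i" for i
    by (simp flip: xy)
  then have "y $ i \<in> \<int>" for i
    using x_int by simp
  with x_int show ?thesis using real_vecI by meson
qed

lemma free_sum_zero:
  assumes "free_sum P Q"
  shows "0 \<in> P" "0 \<in> Q"
proof -
  obtain g where g: "g \<in> SL_int" "0 \<in> (*v) g ` P" "0 \<in> (*v) g ` Q"
    using assms by (auto simp: free_sum_def)
  then show "0 \<in> P" "0 \<in> Q"
    using SL_int_mult_eq_0[OF g(1)] by (metis imageE)+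
qed

lemma free_sum_span_Int:
  assumes "free_sum P Q" "x \<in> span P" "x \<in> span Q"
  shows "x = 0"
proof -
  obtain g where g: "g \<in> SL_int"
    and orth: "\<And>x y. x \<in> span ((*v) g ` P) \<Longrightarrow> y \<in> span ((*v) g ` Q) \<Longrightarrow> orthogonal x y"
    using assms(1) by (auto simp: free_sum_def)
  have "orthogonal (g *v x) (g *v x)"
    using assms(2,3) by (intro orth) (auto simp: span_linear_image)
  then have "g *v x = 0" by (simp add: orthogonal_self)
  then show ?thesis
    by (rule SL_int_mult_eq_0[OF g])
qed

section \<open>The two directions of the equivalence\<close>

text \<open>The height of the \<open>P\<close> component is rounded down and the slack passes to the
  \<open>Q\<close> component. Assuming only the splitting of lattice points allows use with
  \<open>P\<close> and \<open>Q\<close> exchanged.\<close>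

lemma lattice_point_cone_over_conv_sum_split:
  fixes E :: "(real ^ 'n) set"
  assumes E: "finite E" "P = convex hull E" "0 \<in> P" "polar_dual_lattice_polyhedron P"
    and Q: "convex Q" "0 \<in> Q"
    and split: "\<And>x y. x \<in> span P \<Longrightarrow> y \<in> span Q \<Longrightarrow> x + y = real_vec c \<Longrightarrow>
      \<exists>a b. x = real_vec a \<and> y = real_vec b"
    and c: "(real_vec c, real k) \<in> cone_over (conv_sum P Q)"
  shows "\<exists>i a b. i \<le> k \<and> c = a + b \<and> (real_vec a, real i) \<in> cone_over P \<and>
    (real_vec b, real (k - i)) \<in> cone_over Q"
proof -
  have "convex P" "P \<noteq> {}" "Q \<noteq> {}"
    using E Q by auto
  then obtain x y r s where xy: "real_vec c = x + y" "real k = r + s"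
      "(x, r) \<in> cone_over P" "(y, s) \<in> cone_over Q"
    using c Q by (auto simp: cone_over_conv_sum)
  then obtain a b where ab: "x = real_vec a" "y = real_vec b"
    using split[of x y] cone_over_in_span by metis
  have rs: "0 \<le> r" "0 \<le> s"
    using xy by (auto simp: cone_over_iff)
  define i where "i = nat \<lfloor>r\<rfloor>"
  have i: "real i = of_int \<lfloor>r\<rfloor>" "real i \<le> r"
    using rs by (auto simp: i_def)
  have "(real_vec a, real i) \<in> cone_over P"
    using cone_over_floor[of E a r] E xy ab by (simp add: i(1))
  moreover have "i \<le> k"
    using i rs xy(2) by linarith
  moreover have "(real_vec b, real (k - i)) \<in> cone_over Q"
    using cone_over_mono[OF Q, of y s "real (k - i)"] xy ab i \<open>i \<le> k\<close> by (simp add: of_nat_diff)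
  moreover have "c = a + b"
    using xy(1) ab by (simp flip: real_vec_add)
  ultimately show ?thesis by blast
qed

text \<open>Here \<open>t\<close> is the gauge of the lattice point: a non-lattice vertex of the
  dual attains it and bounds every other height from below. Passing to a multiple of the point
  scales the gauge, which adjusts its fractional part.\<close>

lemma nonlattice_gauge_small_frac:
  fixes E :: "(real ^ 'n) set"
  assumes "finite E" "\<And>v i. v \<in> E \<Longrightarrow> v $ i \<in> \<rat>" "P = convex hull E" "E \<noteq> {}"
    and "\<not> polar_dual_lattice_polyhedron P"
  obtains a t k where "(real_vec a, t) \<in> cone_over P"
    "\<And>r. (real_vec a, r) \<in> cone_over P \<Longrightarrow> t \<le> r" "of_int k < t" "t \<le> of_int k + 1 / 2"
proof -
  obtain \<phi> where \<phi>: "\<phi> extreme_point_of polar_dual P" "\<phi> \<notin> dual_lattice (span P)"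
    using assms(5) by (auto simp: polar_dual_lattice_polyhedron_def)
  then obtain a where a: "(real_vec a, blinfun_apply \<phi> (real_vec a)) \<in> cone_over P"
      "blinfun_apply \<phi> (real_vec a) \<notin> \<int>"
    using nonlattice_vertex_attained_nonint[of E \<phi>] assms by blast
  obtain m k where mk: "of_int k < real m * blinfun_apply \<phi> (real_vec a)"
      "real m * blinfun_apply \<phi> (real_vec a) \<le> of_int k + 1 / 2"
    using nat_multiple_small_frac[OF a(2)] by blast
  have ma: "real m *\<^sub>R real_vec a = real_vec (\<chi> i. int m * a $ i)"
    by (simp add: real_vec_def vec_eq_iff)
  have eq: "blinfun_apply \<phi> (real_vec (\<chi> i. int m * a $ i)) = real m * blinfun_apply \<phi> (real_vec a)"
    by (simp add: blinfun.scaleR_right flip: ma)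
  have "(real_vec (\<chi> i. int m * a $ i), real m * blinfun_apply \<phi> (real_vec a)) \<in> cone_over P"
    using cone_over_scale[OF a(1), of "real m"] by (simp add: ma)
  moreover have "real m * blinfun_apply \<phi> (real_vec a) \<le> r"
    if "(real_vec (\<chi> i. int m * a $ i), r) \<in> cone_over P" for r
    using polar_dual_le[OF _ that, of \<phi>] \<phi>(1) by (simp add: extreme_point_of_def eq)
  ultimately show thesis using that mk by blast
qed

lemma rational_polytope_eq_hull:
  assumes "rational_polytope P"
  obtains E where "finite E" "P = convex hull E" "\<And>v i. v \<in> E \<Longrightarrow> v $ i \<in> \<rat>"
proof
  have "polytope P" using assms by (simp add: rational_polytope_def)
  then show "finite {v. v extreme_point_of P}"
    by (intro finite_polyhedron_extreme_points polytope_imp_polyhedron)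
  show "P = convex hull {v. v extreme_point_of P}"
    using \<open>polytope P\<close> by (intro Krein_Milman_Minkowski polytope_imp_compact polytope_imp_convex)
  show "v $ i \<in> \<rat>" if "v \<in> {v. v extreme_point_of P}" for v i
    using assms that by (simp add: rational_polytope_def)
qed

text \<open>The difference of two decompositions lies in both spans, which meet only in 0.\<close>

lemma free_sum_lattice_points_inj:
  assumes "free_sum P Q" "(real_vec a, r) \<in> cone_over P" "(real_vec a', r') \<in> cone_over P"
    "(real_vec b, s) \<in> cone_over Q" "(real_vec b', s') \<in> cone_over Q" "a + b = a' + b'"
  shows "a = a' \<and> b = b'"
proof -
  have "real_vec a - real_vec a' = real_vec b' - real_vec b"
    using assms(6) by (simp add: algebra_simps flip: real_vec_add)
  moreover have "real_vec a - real_vec a' \<in> span P" "real_vec b' - real_vec b \<in> span Q"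
    using assms by (auto intro!: span_diff dest: cone_over_in_span)
  ultimately have "real_vec a - real_vec a' = 0"
    using free_sum_span_Int[OF assms(1)] by metis
  then have "a = a'" by simp
  with assms(6) show ?thesis by simp
qed

theorem theorem1p3:
  fixes P Q :: "(real ^ 'n) set"
  assumes "rational_polytope P" and "rational_polytope Q"
    and "free_sum P Q"
  shows "lattice_gf (cone_over (conv_sum P Q)) =
           (1 - fps_X) * lattice_gf (cone_over P) * lattice_gf (cone_over Q) \<longleftrightarrow>
         polar_dual_lattice_polyhedron P \<or> polar_dual_lattice_polyhedron Q"
proof -
  obtain E where E: "finite E" "P = convex hull E" "\<And>v i. v \<in> E \<Longrightarrow> v $ i \<in> \<rat>"
    using rational_polytope_eq_hull[OF assms(1)] by blast
  obtain F where F: "finite F" "Q = convex hull F" "\<And>v i. v \<in> F \<Longrightarrow> v $ i \<in> \<rat>"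
    using rational_polytope_eq_hull[OF assms(2)] by blast
  have zero: "0 \<in> P" "0 \<in> Q"
    using free_sum_zero[OF assms(3)] by auto
  have conv: "convex P" "convex Q" and bdd: "bounded P" "bounded Q"
    using E F by (auto simp: finite_imp_bounded_convex_hull)
  define L where "L K k = {a. (real_vec a, real k) \<in> cone_over K}" for K :: "(real ^ 'n) set" and k
  define M where "M k = {a + b | i a b. i \<le> k \<and> a \<in> L P i \<and> b \<in> L Q (k - i)}" for k
  have gf: "lattice_gf (cone_over K) = Abs_fps (\<lambda>k. \<Sum>a\<in>L K k. Poly_Mapping.single a 1)"
    for K :: "(real ^ 'n) set"
    by (simp add: lattice_gf_def L_def)
  have fin: "finite (L K k)" if "bounded K" for K k
    using finite_cone_over_slice[OF that] by (simp add: L_def)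
  have mono_L: "mono (L K)" if "convex K" "0 \<in> K" for K
    using cone_over_mono[OF that] by (auto simp: mono_def L_def)
  have "(1 - fps_X) * lattice_gf (cone_over P) * lattice_gf (cone_over Q) =
      Abs_fps (\<lambda>k. \<Sum>c\<in>M k. Poly_Mapping.single c 1)"
    unfolding gf M_def
  proof (rule fps_filtration_mult)
    show "a = a' \<and> b = b'" if "a \<in> L P i" "a' \<in> L P i" "b \<in> L Q j" "b' \<in> L Q j" "a + b = a' + b'"
      for i j a a' b b'
      using free_sum_lattice_points_inj[OF assms(3)] that by (auto simp: L_def)
  qed (use fin bdd mono_L conv zero in auto)
  moreover have "finite (M k)" for k
  proof (rule finite_subset)
    show "M k \<subseteq> (\<lambda>(a, b). a + b) ` (L P k \<times> L Q k)"
      using monoD[OF mono_L[OF conv(1) zero(1)], of _ k] monoD[OF mono_L[OF conv(2) zero(2)], of "k - _" k]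
      by (fastforce simp: M_def)
  qed (use fin bdd in auto)
  moreover have "finite (L (conv_sum P Q) k)" for k
    using bdd by (intro fin) (simp add: conv_sum_def bounded_convex_hull)
  ultimately have "lattice_gf (cone_over (conv_sum P Q)) =
      (1 - fps_X) * lattice_gf (cone_over P) * lattice_gf (cone_over Q) \<longleftrightarrow>
      (\<forall>k. L (conv_sum P Q) k = M k)"
    by (simp add: gf fps_eq_iff sum_single_eq_iff)
  \<comment> \<open>One inclusion always holds, by adding heights; the identity can fail only
    through lattice points of the free sum's cone that do not split at integer heights.\<close>
  also have "\<dots> \<longleftrightarrow> (\<forall>k. L (conv_sum P Q) k \<subseteq> M k)"
  proof -
    have "M k \<subseteq> L (conv_sum P Q) k" for k
    proof
      fix c assume "c \<in> M k"
      then obtain i a b where *: "i \<le> k" "(real_vec a, real i) \<in> cone_over P"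
          "(real_vec b, real (k - i)) \<in> cone_over Q" "c = a + b"
        by (auto simp: M_def L_def)
      have "real k = real i + real (k - i)"
        using *(1) by simp
      then have "(real_vec c, real k) \<in> cone_over (conv_sum P Q)"
        using cone_over_conv_sumI[OF conv *(2,3)] by (simp only: *(4) real_vec_add)
      then show "c \<in> L (conv_sum P Q) k"
        by (simp add: L_def)
    qed
    then show ?thesis by blast
  qed
  also have "\<dots> \<longleftrightarrow> polar_dual_lattice_polyhedron P \<or> polar_dual_lattice_polyhedron Q"
  proof
    assume "polar_dual_lattice_polyhedron P \<or> polar_dual_lattice_polyhedron Q"
    then show "\<forall>k. L (conv_sum P Q) k \<subseteq> M k"
    proof (elim disjE; intro allI subsetI)
      fix k c assume lat: "polar_dual_lattice_polyhedron P" and "c \<in> L (conv_sum P Q) k"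
      then have "(real_vec c, real k) \<in> cone_over (conv_sum P Q)"
        by (simp add: L_def)
      then obtain i a b where "i \<le> k" "c = a + b" "(real_vec a, real i) \<in> cone_over P"
          "(real_vec b, real (k - i)) \<in> cone_over Q"
        using lattice_point_cone_over_conv_sum_split[OF E(1,2) zero(1) lat conv(2) zero(2), of c k] free_sum_lattice[OF assms(3)]
        by metis
      then show "c \<in> M k"
        unfolding M_def L_def by blast
    next
      fix k c assume lat: "polar_dual_lattice_polyhedron Q" and "c \<in> L (conv_sum P Q) k"
      then have "(real_vec c, real k) \<in> cone_over (conv_sum Q P)"
        by (simp add: L_def conv_sum_def Un_commute)
      moreover have "\<exists>a b. x = real_vec a \<and> y = real_vec b"
        if "x \<in> span Q" "y \<in> span P" "x + y = real_vec c" for x y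
        using free_sum_lattice[OF assms(3) that(2,1), of c] that(3) by (auto simp: add.commute)
      ultimately obtain i a b where *: "i \<le> k" "c = a + b" "(real_vec a, real i) \<in> cone_over Q"
          "(real_vec b, real (k - i)) \<in> cone_over P"
        using lattice_point_cone_over_conv_sum_split[OF F(1,2) zero(2) lat conv(1) zero(1), of c k] by metis
      \<comment> \<open>Exchanging the roles of \<open>P\<close> and \<open>Q\<close> turns the
        level \<open>i\<close> into \<open>k - i\<close>.\<close>
      then have "c = b + a" "k - i \<le> k" "k - (k - i) = i"
        by (auto simp: add.commute)
      with * show "c \<in> M k"
        unfolding M_def L_def mem_Collect_eq by metis
    qed
  next
    assume sub: "\<forall>k. L (conv_sum P Q) k \<subseteq> M k"
    show "polar_dual_lattice_polyhedron P \<or> polar_dual_lattice_polyhedron Q"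
    proof (rule ccontr)
      assume not: "\<not> (polar_dual_lattice_polyhedron P \<or> polar_dual_lattice_polyhedron Q)"
      have "E \<noteq> {}" "F \<noteq> {}"
        using E F zero by auto
      obtain a s m where a: "(real_vec a, s) \<in> cone_over P"
          "\<And>r. (real_vec a, r) \<in> cone_over P \<Longrightarrow> s \<le> r" "of_int m < s" "s \<le> of_int m + 1 / 2"
        using nonlattice_gauge_small_frac[OF E(1,3,2) \<open>E \<noteq> {}\<close>] not by metis
      obtain b t n where b: "(real_vec b, t) \<in> cone_over Q"
          "\<And>r. (real_vec b, r) \<in> cone_over Q \<Longrightarrow> t \<le> r" "of_int n < t" "t \<le> of_int n + 1 / 2"
        using nonlattice_gauge_small_frac[OF F(1,3,2) \<open>F \<noteq> {}\<close>] not by metis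
      txt \<open>The gauges \<open>s\<close>, \<open>t\<close> round up together to \<open>k\<close>, but separately to \<open>m + 1\<close> and \<open>n + 1\<close>, one too many.\<close>
      have "0 \<le> s" "0 \<le> t"
        using a(1) b(1) by (auto simp: cone_over_iff)
      \<comment> \<open>This keeps \<open>nat\<close> from truncating in the definition of
        \<open>k\<close>.\<close>
      then have "0 \<le> m + n + 1"
        using a(4) b(4) by linarith
      define k where "k = nat (m + n + 1)"
      have k: "real k = of_int m + of_int n + 1" "s + t \<le> real k"
        using \<open>0 \<le> m + n + 1\<close> a(4) b(4) by (simp_all add: k_def)
      have "(real_vec b, real k - s) \<in> cone_over Q"
        using cone_over_mono[OF conv(2) zero(2) b(1)] k(2) by simp
      then have "(real_vec (a + b), real k) \<in> cone_over (conv_sum P Q)"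
        using cone_over_conv_sumI[OF conv a(1), of "real_vec b" "real k - s"] by (simp add: real_vec_add)
      then have "a + b \<in> M k"
        using sub by (auto simp: L_def)
      then obtain i a' b' where i: "i \<le> k" "(real_vec a', real i) \<in> cone_over P"
          "(real_vec b', real (k - i)) \<in> cone_over Q" "a + b = a' + b'"
        by (auto simp: M_def L_def)
      \<comment> \<open>Uniqueness of the splitting identifies \<open>a'\<close> with
        \<open>a\<close> and \<open>b'\<close> with \<open>b\<close>, so the levels are bounded
        below by the gauges.\<close>
      with free_sum_lattice_points_inj[OF assms(3) a(1) i(2) b(1) i(3)]
      have "s \<le> real i" "t \<le> real (k - i)"
        using a(2) b(2) by auto
      then have "of_int m < real i" "of_int n < real (k - i)"
        using a(3) b(3) by auto
      then have "m < int i" "n < int (k - i)"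
        by linarith+
      then show False
        using i(1) \<open>0 \<le> m + n + 1\<close> by (simp add: k_def)
    qed
  qed
  finally show ?thesis .
qed

end
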